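(* Let $G$ be a finitely generated group and let $\mathcal{C}$ be a category equipped with a coherent $G$-action. Then the canonical strictification model $\mathcal{C}^{strict}$ is equivalent to $\mathcal{C}$.
   Context: Coherent action: a coherent $G$-action on $\mathcal{C}$ (an additive category) consists of autoequivalences $\{T_g\}_{g\in G}$ with $T_e=\mathrm{id}_{\mathcal{C}}$ and isomorphisms of functors $\varphi_{g_1,g_0}:T_{g_1}\circ T_{g_0}\xrightarrow{\sim}T_{g_1g_0}$, equal to the identity when $g_0=e$ or $g_1=e$, such that for all $g_1,g_2,g_3$ and all objects $X$: $\varphi_{g_3g_2,g_1}\circ(\varphi_{g_3,g_2})_{T_{g_1}X}=\varphi_{g_3,g_2g_1}\circ T_{g_3}((\varphi_{g_2,g_1})_X)$ as maps $T_{g_3}T_{g_2}T_{g_1}X\to T_{g_3g_2g_1}X$. Canonical strictification model $\mathcal{C}^{strict}$: (1) Objects: $\mathscr{X}=((\mathscr{X}_g)_{g\in G},\mathcal{F})$ with $\mathscr{X}_g\in Ob(\mathcal{C})$ and $\mathcal{F}=\{\mathcal{F}_g\}_{g\in G}$, where $\mathcal{F}_g$ is a family of isomorphisms $\mathcal{F}_{g,h}:\mathscr{X}_{gh}\to T_g\mathscr{X}_h$, $h\in G$, such that $\mathcal{F}_{e,h}=\mathrm{id}$ and $\varphi_{g_1,g_0}^{-1}\circ\mathcal{F}_{g_1g_0,h}=T_{g_1}(\mathcal{F}_{g_0,h})\circ\mathcal{F}_{g_1,g_0h}$ for all $g_0,g_1,h$ (a compatible system of isomorphisms). (2) Morphisms: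 $hom_{\mathcal{C}^{strict}}(\mathscr{X},\mathscr{Y})=hom_{\mathcal{C}}(\mathscr{X}_e,\mathscr{Y}_e)$. (3) Strict (right) $G$-action: for $s\in G$, $\mathscr{X}\cdot s=((\mathscr{X}_{gs})_{g\in G},\widetilde{\mathcal{F}})$ with $\widetilde{\mathcal{F}}_{g,h}=\mathcal{F}_{g,hs}$; for $\Phi\in hom(\mathscr{X},\mathscr{Y})$, $\Phi\cdot s=(\mathcal{F}^{\mathscr{Y}}_{s,e})^{-1}\circ T_s(\Phi)\circ\mathcal{F}^{\mathscr{X}}_{s,e}$. *)

theory Defs
  imports "HOL-Algebra.Generated_Groups" "HOL-Library.FuncSet"
begin

section \<open>Categories\<close>

text \<open>
  Hom-sets are indexed by source and target and are not required to be disjoint; identities,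
  composition and the morphism part of a functor therefore take the objects involved as arguments.
  \<open>Comp C X Y Z g f\<close> is \<open>g \<circ> f\<close> for \<open>f : X \<rightarrow> Y\<close> and \<open>g : Y \<rightarrow> Z\<close>.
\<close>

record ('o, 'm) category =
  Obj :: "'o set"
  Hom :: "'o \<Rightarrow> 'o \<Rightarrow> 'm set"
  Id :: "'o \<Rightarrow> 'm"
  Comp :: "'o \<Rightarrow> 'o \<Rightarrow> 'o \<Rightarrow> 'm \<Rightarrow> 'm \<Rightarrow> 'm"

locale category =
  fixes C (structure)
  assumes Id_in_Hom: "X \<in> Obj C \<Longrightarrow> Id C X \<in> Hom C X X"
    and Comp_in_Hom:
      "\<lbrakk>X \<in> Obj C; Y \<in> Obj C; Z \<in> Obj C; f \<in> Hom C X Y; g \<in> Hom C Y Z\<rbrakk>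
        \<Longrightarrow> Comp C X Y Z g f \<in> Hom C X Z"
    and Comp_Id_left:
      "\<lbrakk>X \<in> Obj C; Y \<in> Obj C; f \<in> Hom C X Y\<rbrakk> \<Longrightarrow> Comp C X Y Y (Id C Y) f = f"
    and Comp_Id_right:
      "\<lbrakk>X \<in> Obj C; Y \<in> Obj C; f \<in> Hom C X Y\<rbrakk> \<Longrightarrow> Comp C X X Y f (Id C X) = f"
    and Comp_assoc:
      "\<lbrakk>W \<in> Obj C; X \<in> Obj C; Y \<in> Obj C; Z \<in> Obj C;
        f \<in> Hom C W X; g \<in> Hom C X Y; h \<in> Hom C Y Z\<rbrakk>
        \<Longrightarrow> Comp C W X Z (Comp C X Y Z h g) f = Comp C W Y Z h (Comp C W X Y g f)"

definition inverse_morphisms ::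
  "('o, 'm, 'z) category_scheme \<Rightarrow> 'o \<Rightarrow> 'o \<Rightarrow> 'm \<Rightarrow> 'm \<Rightarrow> bool" where
  "inverse_morphisms C X Y f g \<longleftrightarrow>
     f \<in> Hom C X Y \<and> g \<in> Hom C Y X \<and> Comp C X Y X g f = Id C X \<and> Comp C Y X Y f g = Id C Y"

definition Iso :: "('o, 'm, 'z) category_scheme \<Rightarrow> 'o \<Rightarrow> 'o \<Rightarrow> 'm set" where
  "Iso C X Y = {f. \<exists>g. inverse_morphisms C X Y f g}"

definition Inv :: "('o, 'm, 'z) category_scheme \<Rightarrow> 'o \<Rightarrow> 'o \<Rightarrow> 'm \<Rightarrow> 'm" where
  "Inv C X Y f = (THE g. inverse_morphisms C X Y f g)"


section \<open>Additive categories\<close>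

definition preadditive_structure ::
  "('o, 'm, 'z) category_scheme \<Rightarrow> ('o \<Rightarrow> 'o \<Rightarrow> 'm \<Rightarrow> 'm \<Rightarrow> 'm) \<Rightarrow> ('o \<Rightarrow> 'o \<Rightarrow> 'm) \<Rightarrow> bool" where
  "preadditive_structure C padd pzero \<longleftrightarrow>
     (\<forall>X\<in>Obj C. \<forall>Y\<in>Obj C.
        comm_group \<lparr>carrier = Hom C X Y, monoid.mult = padd X Y, one = pzero X Y\<rparr>) \<and>
     (\<forall>X\<in>Obj C. \<forall>Y\<in>Obj C. \<forall>Z\<in>Obj C. \<forall>f\<in>Hom C X Y. \<forall>g\<in>Hom C Y Z. \<forall>g'\<in>Hom C Y Z.
        Comp C X Y Z (padd Y Z g g') f = padd X Z (Comp C X Y Z g f) (Comp C X Y Z g' f)) \<and>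
     (\<forall>X\<in>Obj C. \<forall>Y\<in>Obj C. \<forall>Z\<in>Obj C. \<forall>f\<in>Hom C X Y. \<forall>f'\<in>Hom C X Y. \<forall>g\<in>Hom C Y Z.
        Comp C X Y Z g (padd X Y f f') = padd X Z (Comp C X Y Z g f) (Comp C X Y Z g f'))"

definition zero_object :: "('o, 'm, 'z) category_scheme \<Rightarrow> 'o \<Rightarrow> bool" where
  "zero_object C Z \<longleftrightarrow>
     Z \<in> Obj C \<and> (\<forall>X\<in>Obj C. (\<exists>!f. f \<in> Hom C X Z) \<and> (\<exists>!f. f \<in> Hom C Z X))"

definition binary_product ::
  "('o, 'm, 'z) category_scheme \<Rightarrow> 'o \<Rightarrow> 'o \<Rightarrow> 'o \<Rightarrow> 'm \<Rightarrow> 'm \<Rightarrow> bool" where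
  "binary_product C X Y P p q \<longleftrightarrow>
     P \<in> Obj C \<and> p \<in> Hom C P X \<and> q \<in> Hom C P Y \<and>
     (\<forall>W\<in>Obj C. \<forall>f\<in>Hom C W X. \<forall>g\<in>Hom C W Y.
        \<exists>!h. h \<in> Hom C W P \<and> Comp C W P X p h = f \<and> Comp C W P Y q h = g)"

text \<open>
  The abelian group structure on the hom-sets is unique when it exists together with a zero object
  and binary products, so additivity is a property of a category, and equivalences between
  additive categories are automatically additive.
\<close>

locale additive_category = category +
  assumes preadditive: "\<exists>padd pzero. preadditive_structure C padd pzero"
    and ex_zero_object: "\<exists>Z. zero_object C Z"
    and ex_binary_product:
      "\<lbrakk>X \<in> Obj C; Y \<in> Obj C\<rbrakk> \<Longrightarrow> \<exists>P p q. binary_product C X Y P p q"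


section \<open>Functors and equivalences\<close>

record ('o, 'm, 'o', 'm') functor_data =
  omap :: "'o \<Rightarrow> 'o'"
  fmap :: "'o \<Rightarrow> 'o \<Rightarrow> 'm \<Rightarrow> 'm'"

definition id_functor :: "('o, 'm, 'o, 'm) functor_data" where
  "id_functor = \<lparr>omap = \<lambda>X. X, fmap = \<lambda>X Y f. f\<rparr>"

definition comp_functor ::
  "('b, 'n, 'c, 'p) functor_data \<Rightarrow> ('a, 'm, 'b, 'n) functor_data \<Rightarrow> ('a, 'm, 'c, 'p) functor_data"
  where
  "comp_functor K H =
     \<lparr>omap = \<lambda>X. omap K (omap H X),
      fmap = \<lambda>X Y f. fmap K (omap H X) (omap H Y) (fmap H X Y f)\<rparr>"

definition is_functor ::
  "('a, 'm, 'z) category_scheme \<Rightarrow> ('b, 'n, 'y) category_scheme \<Rightarrow>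
   ('a, 'm, 'b, 'n) functor_data \<Rightarrow> bool" where
  "is_functor A B H \<longleftrightarrow>
     category A \<and> category B \<and>
     (\<forall>X\<in>Obj A. omap H X \<in> Obj B) \<and>
     (\<forall>X\<in>Obj A. \<forall>Y\<in>Obj A. \<forall>f\<in>Hom A X Y. fmap H X Y f \<in> Hom B (omap H X) (omap H Y)) \<and>
     (\<forall>X\<in>Obj A. fmap H X X (Id A X) = Id B (omap H X)) \<and>
     (\<forall>X\<in>Obj A. \<forall>Y\<in>Obj A. \<forall>Z\<in>Obj A. \<forall>f\<in>Hom A X Y. \<forall>g\<in>Hom A Y Z.
        fmap H X Z (Comp A X Y Z g f) =
        Comp B (omap H X) (omap H Y) (omap H Z) (fmap H Y Z g) (fmap H X Y f))"

definition natural_iso ::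
  "('a, 'm, 'z) category_scheme \<Rightarrow> ('b, 'n, 'y) category_scheme \<Rightarrow>
   ('a, 'm, 'b, 'n) functor_data \<Rightarrow> ('a, 'm, 'b, 'n) functor_data \<Rightarrow> ('a \<Rightarrow> 'n) \<Rightarrow> bool" where
  "natural_iso A B H K \<alpha> \<longleftrightarrow>
     is_functor A B H \<and> is_functor A B K \<and>
     (\<forall>X\<in>Obj A. \<alpha> X \<in> Iso B (omap H X) (omap K X)) \<and>
     (\<forall>X\<in>Obj A. \<forall>Y\<in>Obj A. \<forall>f\<in>Hom A X Y.
        Comp B (omap H X) (omap H Y) (omap K Y) (\<alpha> Y) (fmap H X Y f) =
        Comp B (omap H X) (omap K X) (omap K Y) (fmap K X Y f) (\<alpha> X))"

definition is_equivalence ::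
  "('a, 'm, 'z) category_scheme \<Rightarrow> ('b, 'n, 'y) category_scheme \<Rightarrow>
   ('a, 'm, 'b, 'n) functor_data \<Rightarrow> bool" where
  "is_equivalence A B H \<longleftrightarrow>
     is_functor A B H \<and>
     (\<exists>K. is_functor B A K \<and>
        (\<exists>\<alpha>. natural_iso A A (comp_functor K H) id_functor \<alpha>) \<and>
        (\<exists>\<beta>. natural_iso B B (comp_functor H K) id_functor \<beta>))"

definition equivalent_categories ::
  "('a, 'm, 'z) category_scheme \<Rightarrow> ('b, 'n, 'y) category_scheme \<Rightarrow> bool" where
  "equivalent_categories A B \<longleftrightarrow> (\<exists>H. is_equivalence A B H)"


section \<open>Coherent group actions\<close>

definition finitely_generated :: "('g, 'z) monoid_scheme \<Rightarrow> bool" where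
  "finitely_generated G \<longleftrightarrow> (\<exists>S. finite S \<and> S \<subseteq> carrier G \<and> generate G S = carrier G)"

text \<open>
  \<open>\<phi> g h X\<close> is the component at \<open>X\<close> of the isomorphism from the composite of \<open>T g\<close> after \<open>T h\<close>
  to \<open>T (g \<otimes> h)\<close>. Functors are given by total functions, so the identity functor is only
  prescribed on the objects and morphisms of \<open>C\<close>.
\<close>

locale coherent_action = group G + additive_category C
  for G (structure) and C +
  fixes T :: "'g \<Rightarrow> ('o, 'm, 'o, 'm) functor_data"
    and \<phi> :: "'g \<Rightarrow> 'g \<Rightarrow> 'o \<Rightarrow> 'm"
  assumes autoequivalence: "g \<in> carrier G \<Longrightarrow> is_equivalence C C (T g)"
    and T_one_omap: "X \<in> Obj C \<Longrightarrow> omap (T \<one>\<^bsub>G\<^esub>) X = X"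
    and T_one_fmap:
      "\<lbrakk>X \<in> Obj C; Y \<in> Obj C; f \<in> Hom C X Y\<rbrakk> \<Longrightarrow> fmap (T \<one>\<^bsub>G\<^esub>) X Y f = f"
    and phi_natural_iso:
      "\<lbrakk>g \<in> carrier G; h \<in> carrier G\<rbrakk>
        \<Longrightarrow> natural_iso C C (comp_functor (T g) (T h)) (T (g \<otimes>\<^bsub>G\<^esub> h)) (\<phi> g h)"
    and phi_one_right:
      "\<lbrakk>g \<in> carrier G; X \<in> Obj C\<rbrakk> \<Longrightarrow> \<phi> g \<one>\<^bsub>G\<^esub> X = Id C (omap (T g) X)"
    and phi_one_left:
      "\<lbrakk>g \<in> carrier G; X \<in> Obj C\<rbrakk> \<Longrightarrow> \<phi> \<one>\<^bsub>G\<^esub> g X = Id C (omap (T g) X)"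
    and phi_coherence:
      "\<lbrakk>g1 \<in> carrier G; g2 \<in> carrier G; g3 \<in> carrier G; X \<in> Obj C\<rbrakk> \<Longrightarrow>
        Comp C (omap (T g3) (omap (T g2) (omap (T g1) X)))
               (omap (T (g3 \<otimes>\<^bsub>G\<^esub> g2)) (omap (T g1) X))
               (omap (T (g3 \<otimes>\<^bsub>G\<^esub> g2 \<otimes>\<^bsub>G\<^esub> g1)) X)
          (\<phi> (g3 \<otimes>\<^bsub>G\<^esub> g2) g1 X)
          (\<phi> g3 g2 (omap (T g1) X)) =
        Comp C (omap (T g3) (omap (T g2) (omap (T g1) X)))
               (omap (T g3) (omap (T (g2 \<otimes>\<^bsub>G\<^esub> g1)) X))
               (omap (T (g3 \<otimes>\<^bsub>G\<^esub> g2 \<otimes>\<^bsub>G\<^esub> g1)) X)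
          (\<phi> g3 (g2 \<otimes>\<^bsub>G\<^esub> g1) X)
          (fmap (T g3) (omap (T g2) (omap (T g1) X)) (omap (T (g2 \<otimes>\<^bsub>G\<^esub> g1)) X) (\<phi> g2 g1 X))"


section \<open>The canonical strictification model\<close>

text \<open>
  Families indexed by the group are extensional functions on its carrier, so that equality of
  objects of the model is equality of the families.
\<close>

type_synonym ('g, 'o, 'm) strict_obj = "('g \<Rightarrow> 'o) \<times> ('g \<Rightarrow> 'g \<Rightarrow> 'm)"

definition strict_objects ::
  "('g, 'z) monoid_scheme \<Rightarrow> ('o, 'm, 'y) category_scheme \<Rightarrow>
   ('g \<Rightarrow> ('o, 'm, 'o, 'm) functor_data) \<Rightarrow> ('g \<Rightarrow> 'g \<Rightarrow> 'o \<Rightarrow> 'm) \<Rightarrow> ('g, 'o, 'm) strict_obj set" where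
  "strict_objects G C T \<phi> = {(X, F).
     X \<in> carrier G \<rightarrow>\<^sub>E Obj C \<and>
     F \<in> (\<Pi>\<^sub>E g\<in>carrier G. \<Pi>\<^sub>E h\<in>carrier G. Iso C (X (g \<otimes>\<^bsub>G\<^esub> h)) (omap (T g) (X h))) \<and>
     (\<forall>h\<in>carrier G. F \<one>\<^bsub>G\<^esub> h = Id C (X h)) \<and>
     (\<forall>g0\<in>carrier G. \<forall>g1\<in>carrier G. \<forall>h\<in>carrier G.
        Comp C (X (g1 \<otimes>\<^bsub>G\<^esub> g0 \<otimes>\<^bsub>G\<^esub> h))
               (omap (T (g1 \<otimes>\<^bsub>G\<^esub> g0)) (X h))
               (omap (T g1) (omap (T g0) (X h)))
          (Inv C (omap (T g1) (omap (T g0) (X h))) (omap (T (g1 \<otimes>\<^bsub>G\<^esub> g0)) (X h)) (\<phi> g1 g0 (X h)))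
          (F (g1 \<otimes>\<^bsub>G\<^esub> g0) h) =
        Comp C (X (g1 \<otimes>\<^bsub>G\<^esub> g0 \<otimes>\<^bsub>G\<^esub> h))
               (omap (T g1) (X (g0 \<otimes>\<^bsub>G\<^esub> h)))
               (omap (T g1) (omap (T g0) (X h)))
          (fmap (T g1) (X (g0 \<otimes>\<^bsub>G\<^esub> h)) (omap (T g0) (X h)) (F g0 h))
          (F g1 (g0 \<otimes>\<^bsub>G\<^esub> h)))}"

definition strict_act ::
  "('g, 'z) monoid_scheme \<Rightarrow> ('o, 'm, 'y) category_scheme \<Rightarrow>
   ('g \<Rightarrow> ('o, 'm, 'o, 'm) functor_data) \<Rightarrow> 'g \<Rightarrow>
   (('g, 'o, 'm) strict_obj, 'm, ('g, 'o, 'm) strict_obj, 'm) functor_data" where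
  "strict_act G C T s =
     \<lparr>omap = \<lambda>(X, F). (\<lambda>g\<in>carrier G. X (g \<otimes>\<^bsub>G\<^esub> s), \<lambda>g\<in>carrier G. \<lambda>h\<in>carrier G. F g (h \<otimes>\<^bsub>G\<^esub> s)),
      fmap = \<lambda>(X, F) (Y, F') f.
        Comp C (X s) (omap (T s) (Y \<one>\<^bsub>G\<^esub>)) (Y s)
          (Inv C (Y s) (omap (T s) (Y \<one>\<^bsub>G\<^esub>)) (F' s \<one>\<^bsub>G\<^esub>))
          (Comp C (X s) (omap (T s) (X \<one>\<^bsub>G\<^esub>)) (omap (T s) (Y \<one>\<^bsub>G\<^esub>))
            (fmap (T s) (X \<one>\<^bsub>G\<^esub>) (Y \<one>\<^bsub>G\<^esub>) f)
            (F s \<one>\<^bsub>G\<^esub>))\<rparr>"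

record ('o, 'm, 'g) acted_category = "('o, 'm) category" +
  act :: "'g \<Rightarrow> ('o, 'm, 'o, 'm) functor_data"

definition strictification ::
  "('g, 'z) monoid_scheme \<Rightarrow> ('o, 'm, 'y) category_scheme \<Rightarrow>
   ('g \<Rightarrow> ('o, 'm, 'o, 'm) functor_data) \<Rightarrow> ('g \<Rightarrow> 'g \<Rightarrow> 'o \<Rightarrow> 'm) \<Rightarrow>
   (('g, 'o, 'm) strict_obj, 'm, 'g) acted_category" where
  "strictification G C T \<phi> =
     \<lparr>Obj = strict_objects G C T \<phi>,
      Hom = \<lambda>\<X> \<Y>. Hom C (fst \<X> \<one>\<^bsub>G\<^esub>) (fst \<Y> \<one>\<^bsub>G\<^esub>),
      Id = \<lambda>\<X>. Id C (fst \<X> \<one>\<^bsub>G\<^esub>),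
      Comp = \<lambda>\<X> \<Y> \<Z>. Comp C (fst \<X> \<one>\<^bsub>G\<^esub>) (fst \<Y> \<one>\<^bsub>G\<^esub>) (fst \<Z> \<one>\<^bsub>G\<^esub>),
      act = strict_act G C T\<rparr>"

end

theory Submission
  imports Defs
begin

text \<open>
  The forgetful functor to the component at the unit of \<open>G\<close> is an equivalence. A quasi-inverse sends
  \<open>X\<close> to its orbit \<open>(T g X)\<close> with the isomorphisms \<open>T (g h) X \<rightarrow> T g (T h X)\<close> inverse to \<open>\<phi> g h X\<close>;
  these are compatible because inverting the coherence axiom of \<open>\<phi>\<close> yields precisely the compatibility
  condition. Since \<open>T \<one>\<close> is the identity, one composite is the identity functor. The other one
  only replaces an object by another one with the same component at the unit, and the identity of
  that component is the required natural isomorphism.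
\<close>

lemma inverse_morphisms_sym:
  "inverse_morphisms C X Y f g \<Longrightarrow> inverse_morphisms C Y X g f"
  by (auto simp: inverse_morphisms_def)

context category
begin

text \<open>The usual computation g = (g' f) g = g' (f g) = g'. It makes the definite description in
  \<open>Inv\<close> well defined, and later turns an equation between morphisms into one between
  their inverses.\<close>

lemma inverse_morphisms_unique:
  assumes "X \<in> Obj C" "Y \<in> Obj C"
    and g: "inverse_morphisms C X Y f g" and g': "inverse_morphisms C X Y f g'"
  shows "g = g'"
proof -
  have "g = Comp C Y X X (Comp C X Y X g' f) g"
    using assms by (simp add: inverse_morphisms_def Comp_Id_left)
  also have "\<dots> = Comp C Y Y X g' (Comp C Y X Y f g)"
    using assms by (intro Comp_assoc) (auto simp: inverse_morphisms_def)
  also have "\<dots> = g'"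
    using assms by (simp add: inverse_morphisms_def Comp_Id_right)
  finally show ?thesis .
qed

lemma Inv_eqI:
  assumes "X \<in> Obj C" "Y \<in> Obj C" "inverse_morphisms C X Y f g"
  shows "Inv C X Y f = g"
  unfolding Inv_def using assms by (blast intro: inverse_morphisms_unique)

lemma inverse_morphisms_Inv:
  assumes "X \<in> Obj C" "Y \<in> Obj C" "f \<in> Iso C X Y"
  shows "inverse_morphisms C X Y f (Inv C X Y f)"
  using assms Inv_eqI by (auto simp: Iso_def)

lemma inverse_morphisms_Id: "X \<in> Obj C \<Longrightarrow> inverse_morphisms C X X (Id C X) (Id C X)"
  by (simp add: inverse_morphisms_def Id_in_Hom Comp_Id_left)

text \<open>Cancels f' f in the middle of a fourfold composite; both identities needed to invert a
  composite are instances.\<close>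

lemma Comp_cancel_inner:
  assumes "X \<in> Obj C" "Y \<in> Obj C" "Z \<in> Obj C" "W \<in> Obj C"
    and "inverse_morphisms C X Y f f'" "h \<in> Hom C X Z" "k \<in> Hom C W X"
  shows "Comp C W Y Z (Comp C Y X Z h f') (Comp C W X Y f k) = Comp C W X Z h k"
proof -
  have "Comp C W Y Z (Comp C Y X Z h f') (Comp C W X Y f k)
      = Comp C W X Z h (Comp C W Y X f' (Comp C W X Y f k))"
    using assms by (intro Comp_assoc) (auto simp: inverse_morphisms_def Comp_in_Hom)
  also have "Comp C W Y X f' (Comp C W X Y f k) = Comp C W X X (Comp C X Y X f' f) k"
    using assms by (intro Comp_assoc[symmetric]) (auto simp: inverse_morphisms_def)
  also have "\<dots> = k"
    using assms by (simp add: inverse_morphisms_def Comp_Id_left)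
  finally show ?thesis .
qed

lemma inverse_morphisms_Comp:
  assumes "X \<in> Obj C" "Y \<in> Obj C" "Z \<in> Obj C"
    and "inverse_morphisms C X Y f f'" "inverse_morphisms C Y Z g g'"
  shows "inverse_morphisms C X Z (Comp C X Y Z g f) (Comp C Z Y X f' g')"
proof -
  have "Comp C X Z X (Comp C Z Y X f' g') (Comp C X Y Z g f) = Id C X"
    using assms Comp_cancel_inner[of Y Z X X g g' f' f] by (auto simp: inverse_morphisms_def)
  moreover have "Comp C Z X Z (Comp C X Y Z g f) (Comp C Z Y X f' g') = Id C Z"
    using assms Comp_cancel_inner[of Y X Z Z f' f g g'] by (auto simp: inverse_morphisms_def)
  ultimately show ?thesis
    using assms by (auto simp: inverse_morphisms_def Comp_in_Hom)
qed

lemma is_functor_id_functor: "is_functor C C id_functor"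
  by (simp add: is_functor_def id_functor_def category_axioms)

end

lemma is_functor_inverse_morphisms:
  assumes "is_functor A B H" "X \<in> Obj A" "Y \<in> Obj A" "inverse_morphisms A X Y f g"
  shows "inverse_morphisms B (omap H X) (omap H Y) (fmap H X Y f) (fmap H Y X g)"
  using assms unfolding is_functor_def inverse_morphisms_def by metis

lemma is_functor_comp_functor:
  assumes "is_functor A B H" "is_functor B D K"
  shows "is_functor A D (comp_functor K H)"
  using assms by (simp add: is_functor_def comp_functor_def)

context coherent_action
begin

abbreviation "Cstrict \<equiv> strictification G C T \<phi>"

text \<open>The inverse is taken because \<open>\<phi>\<close> runs opposite to the structure maps
  of the model; the restrictions to the carrier match its extensional families.\<close>

definition orbit_maps :: "'o \<Rightarrow> 'g \<Rightarrow> 'g \<Rightarrow> 'm" where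
  "orbit_maps X = (\<lambda>g\<in>carrier G. \<lambda>h\<in>carrier G.
     Inv C (omap (T g) (omap (T h) X)) (omap (T (g \<otimes>\<^bsub>G\<^esub> h)) X) (\<phi> g h X))"

definition orbit_object where
  "orbit_object X = (\<lambda>g\<in>carrier G. omap (T g) X, orbit_maps X)"

text \<open>Morphisms can stay unchanged: the model's hom-sets see only unit components, and the
  unit component of the orbit of X is X itself.\<close>

definition orbit_functor where
  "orbit_functor = \<lparr>omap = orbit_object, fmap = \<lambda>X Y f. f\<rparr>"

definition unit_component where
  "unit_component = \<lparr>omap = \<lambda>\<X>. fst \<X> \<one>\<^bsub>G\<^esub>, fmap = \<lambda>\<X> \<Y> f. f\<rparr>"

lemma is_functor_T: "g \<in> carrier G \<Longrightarrow> is_functor C C (T g)"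
  using autoequivalence by (auto simp: is_equivalence_def)

lemma T_in_Obj: "g \<in> carrier G \<Longrightarrow> X \<in> Obj C \<Longrightarrow> omap (T g) X \<in> Obj C"
  using is_functor_T by (simp add: is_functor_def)

lemma phi_in_Iso:
  "\<lbrakk>g \<in> carrier G; h \<in> carrier G; X \<in> Obj C\<rbrakk>
    \<Longrightarrow> \<phi> g h X \<in> Iso C (omap (T g) (omap (T h) X)) (omap (T (g \<otimes>\<^bsub>G\<^esub> h)) X)"
  using phi_natural_iso by (simp add: natural_iso_def comp_functor_def)

lemma inverse_morphisms_phi:
  assumes "g \<in> carrier G" "h \<in> carrier G" "X \<in> Obj C"
  shows "inverse_morphisms C (omap (T g) (omap (T h) X)) (omap (T (g \<otimes>\<^bsub>G\<^esub> h)) X)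
           (\<phi> g h X) (orbit_maps X g h)"
  using inverse_morphisms_Inv[OF _ _ phi_in_Iso] assms by (simp add: orbit_maps_def T_in_Obj)

lemma orbit_maps_one:
  assumes "h \<in> carrier G" "X \<in> Obj C"
  shows "orbit_maps X \<one>\<^bsub>G\<^esub> h = Id C (omap (T h) X)"
  using assms by (simp add: orbit_maps_def T_one_omap T_in_Obj phi_one_left Inv_eqI inverse_morphisms_Id)

text \<open>The two sides are inverse to the two sides of \<open>phi_coherence\<close>, so they
  agree by uniqueness of inverses.\<close>

lemma orbit_maps_compatible:
  assumes g: "g0 \<in> carrier G" "g1 \<in> carrier G" "h \<in> carrier G" and X: "X \<in> Obj C"
  shows "Comp C (omap (T (g1 \<otimes>\<^bsub>G\<^esub> g0 \<otimes>\<^bsub>G\<^esub> h)) X)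
               (omap (T (g1 \<otimes>\<^bsub>G\<^esub> g0)) (omap (T h) X))
               (omap (T g1) (omap (T g0) (omap (T h) X)))
          (orbit_maps (omap (T h) X) g1 g0)
          (orbit_maps X (g1 \<otimes>\<^bsub>G\<^esub> g0) h) =
        Comp C (omap (T (g1 \<otimes>\<^bsub>G\<^esub> g0 \<otimes>\<^bsub>G\<^esub> h)) X)
               (omap (T g1) (omap (T (g0 \<otimes>\<^bsub>G\<^esub> h)) X))
               (omap (T g1) (omap (T g0) (omap (T h) X)))
          (fmap (T g1) (omap (T (g0 \<otimes>\<^bsub>G\<^esub> h)) X) (omap (T g0) (omap (T h) X)) (orbit_maps X g0 h))
          (orbit_maps X g1 (g0 \<otimes>\<^bsub>G\<^esub> h))"
    (is "Comp C ?P ?Q ?S ?b ?a = Comp C ?P ?R ?S ?d ?c")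
proof -
  note objs = T_in_Obj X g m_closed
  have "inverse_morphisms C ?S ?P
     (Comp C ?S ?Q ?P (\<phi> (g1 \<otimes>\<^bsub>G\<^esub> g0) h X) (\<phi> g1 g0 (omap (T h) X))) (Comp C ?P ?Q ?S ?b ?a)"
    by (intro inverse_morphisms_Comp inverse_morphisms_phi objs)
  \<comment> \<open>The component of \<open>\<phi>\<close> ends at the translate by g1 (g0 h),
    whereas \<open>?P\<close> is written with (g1 g0) h; associativity identifies them.\<close>
  moreover have "inverse_morphisms C ?R ?P (\<phi> g1 (g0 \<otimes>\<^bsub>G\<^esub> h) X) ?c"
    using inverse_morphisms_phi[of g1 "g0 \<otimes>\<^bsub>G\<^esub> h" X] g X by (simp add: m_assoc)
  then have "inverse_morphisms C ?S ?P
     (Comp C ?S ?R ?P (\<phi> g1 (g0 \<otimes>\<^bsub>G\<^esub> h) X)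
       (fmap (T g1) (omap (T g0) (omap (T h) X)) (omap (T (g0 \<otimes>\<^bsub>G\<^esub> h)) X) (\<phi> g0 h X)))
     (Comp C ?P ?R ?S ?d ?c)"
    \<comment> \<open>The inner factor is inverted by its image under \<open>T g1\<close>, since
      functors preserve inverse pairs.\<close>
    by (intro inverse_morphisms_Comp is_functor_inverse_morphisms[OF is_functor_T]
        inverse_morphisms_phi objs)
  ultimately show ?thesis
    \<comment> \<open>Coherence numbers the group elements from the innermost outwards, hence the
      order h, g0, g1.\<close>
    using phi_coherence[of h g0 g1 X] g X inverse_morphisms_unique[of ?S ?P]
    by (simp add: T_in_Obj)
qed

lemma orbit_object_in_Obj:
  assumes X: "X \<in> Obj C"
  shows "orbit_object X \<in> Obj Cstrict"
proof -
  have "orbit_maps X \<in> (\<Pi>\<^sub>E g\<in>carrier G. \<Pi>\<^sub>E h\<in>carrier G.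
          Iso C (omap (T (g \<otimes>\<^bsub>G\<^esub> h)) X) (omap (T g) (omap (T h) X)))"
  proof (intro PiE_I)
    fix g h assume "g \<in> carrier G" "h \<in> carrier G"
    then show "orbit_maps X g h \<in> Iso C (omap (T (g \<otimes>\<^bsub>G\<^esub> h)) X) (omap (T g) (omap (T h) X))"
      using inverse_morphisms_sym[OF inverse_morphisms_phi] X unfolding Iso_def by blast
  qed (simp_all add: orbit_maps_def)
  \<comment> \<open>The compatibility condition of the model is phrased with \<open>Inv\<close> of
    \<open>\<phi>\<close> at the component \<open>T h X\<close>, which is an orbit map of that
    component.\<close>
  moreover have "Inv C (omap (T g1) (omap (T g0) (omap (T h) X)))
      (omap (T (g1 \<otimes>\<^bsub>G\<^esub> g0)) (omap (T h) X)) (\<phi> g1 g0 (omap (T h) X)) =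
      orbit_maps (omap (T h) X) g1 g0"
    if "g0 \<in> carrier G" "g1 \<in> carrier G" for g0 g1 h
    using that by (simp add: orbit_maps_def)
  ultimately show ?thesis
    using orbit_maps_compatible orbit_maps_one X
    by (auto simp: strictification_def strict_objects_def orbit_object_def T_in_Obj PiE_iff)
qed

lemma unit_component_in_Obj: "\<X> \<in> Obj Cstrict \<Longrightarrow> fst \<X> \<one>\<^bsub>G\<^esub> \<in> Obj C"
  by (auto simp: strictification_def strict_objects_def)

lemma unit_component_orbit_object: "X \<in> Obj C \<Longrightarrow> fst (orbit_object X) \<one>\<^bsub>G\<^esub> = X"
  by (simp add: orbit_object_def T_one_omap)

lemma strictification_simps:
  "Hom Cstrict \<X> \<Y> = Hom C (fst \<X> \<one>\<^bsub>G\<^esub>) (fst \<Y> \<one>\<^bsub>G\<^esub>)"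
  "Id Cstrict \<X> = Id C (fst \<X> \<one>\<^bsub>G\<^esub>)"
  "Comp Cstrict \<X> \<Y> \<Z> = Comp C (fst \<X> \<one>\<^bsub>G\<^esub>) (fst \<Y> \<one>\<^bsub>G\<^esub>) (fst \<Z> \<one>\<^bsub>G\<^esub>)"
  by (simp_all add: strictification_def)

text \<open>Each law is the law of \<open>C\<close> at unit components; the structure maps do not
  enter.\<close>

lemma category_strictification: "category Cstrict"
  by unfold_locales
    (auto simp: strictification_simps unit_component_in_Obj
      Id_in_Hom Comp_in_Hom Comp_Id_left Comp_Id_right Comp_assoc)

lemma is_functor_unit_component: "is_functor Cstrict C unit_component"
  by (simp add: is_functor_def unit_component_def category_strictification category_axioms
      strictification_simps unit_component_in_Obj)

lemma is_functor_orbit_functor: "is_functor C Cstrict orbit_functor"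
  by (simp add: is_functor_def orbit_functor_def category_strictification category_axioms
      strictification_simps orbit_object_in_Obj unit_component_orbit_object)

lemma natural_iso_orbit_unit_component:
  "natural_iso Cstrict Cstrict (comp_functor orbit_functor unit_component) id_functor
     (\<lambda>\<X>. Id C (fst \<X> \<one>\<^bsub>G\<^esub>))"
  unfolding natural_iso_def
proof (intro conjI ballI
    is_functor_comp_functor[OF is_functor_unit_component is_functor_orbit_functor]
    category.is_functor_id_functor[OF category_strictification])
  \<comment> \<open>Morphisms of the model need not respect the structure maps, so equal unit
    components already make the identity an isomorphism.\<close>
  fix \<X> assume "\<X> \<in> Obj Cstrict"
  then have "inverse_morphisms Cstrict (orbit_object (fst \<X> \<one>\<^bsub>G\<^esub>)) \<X>
      (Id C (fst \<X> \<one>\<^bsub>G\<^esub>)) (Id C (fst \<X> \<one>\<^bsub>G\<^esub>))"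
    using inverse_morphisms_Id[of "fst \<X> \<one>\<^bsub>G\<^esub>"]
    by (simp add: inverse_morphisms_def strictification_simps unit_component_in_Obj
        unit_component_orbit_object)
  then show "Id C (fst \<X> \<one>\<^bsub>G\<^esub>) \<in> Iso Cstrict
      (omap (comp_functor orbit_functor unit_component) \<X>) (omap id_functor \<X>)"
    by (auto simp: Iso_def comp_functor_def orbit_functor_def unit_component_def id_functor_def)
qed (auto simp: comp_functor_def orbit_functor_def unit_component_def id_functor_def strictification_simps
    unit_component_orbit_object unit_component_in_Obj Comp_Id_left Comp_Id_right)

text \<open>\<open>T \<one>\<close> fixes X only for X in \<open>Obj C\<close>, so the composite is
  compared with the identity functor through identity components, not as equal records.\<close>

lemma natural_iso_unit_component_orbit:
  "natural_iso C C (comp_functor unit_component orbit_functor) id_functor (Id C)"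
  unfolding natural_iso_def
proof (intro conjI ballI is_functor_id_functor
    is_functor_comp_functor[OF is_functor_orbit_functor is_functor_unit_component])
  fix X assume "X \<in> Obj C"
  then show "Id C X \<in> Iso C
      (omap (comp_functor unit_component orbit_functor) X) (omap id_functor X)"
    using inverse_morphisms_Id[of X]
    by (auto simp: Iso_def comp_functor_def orbit_functor_def unit_component_def id_functor_def
        unit_component_orbit_object)
qed (auto simp: comp_functor_def orbit_functor_def unit_component_def id_functor_def
    unit_component_orbit_object Comp_Id_left Comp_Id_right)

lemma is_equivalence_unit_component: "is_equivalence Cstrict C unit_component"
  unfolding is_equivalence_def
  using is_functor_unit_component is_functor_orbit_functor
    natural_iso_orbit_unit_component natural_iso_unit_component_orbit by blast

end

theorem proposition2p22:
  fixes G :: "('g, 'z) monoid_scheme"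
    and C :: "('o, 'm, 'y) category_scheme"
    and T :: "'g \<Rightarrow> ('o, 'm, 'o, 'm) functor_data"
    and \<phi> :: "'g \<Rightarrow> 'g \<Rightarrow> 'o \<Rightarrow> 'm"
  assumes "group G"
    and "finitely_generated G"
    and "additive_category C"
    and "coherent_action G C T \<phi>"
  shows "equivalent_categories (strictification G C T \<phi>) C"
  unfolding equivalent_categories_def
  using coherent_action.is_equivalence_unit_component[OF assms(4)] by blast

end
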